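(* Let $N\ge2$ and $d\ge1$ be integers. Let $f:\mathbb{Z}_N^d\to\mathbb{C}$ be supported in $E\subset\mathbb{Z}_N^d$ and let $S\subset\mathbb{Z}_N^d$ (the set of unobserved frequencies). Suppose that there exist $C>0$ and $\alpha\in[2,3]$ such that $\Lambda(S)\le C|S|^{\alpha}$. Let $$\delta=\left(\frac{|E|\,\Lambda^{\frac13}(S)}{N^d}\right)^{\frac34}.$$ If $\delta<\frac12$ and $g:\mathbb{Z}_N^d\to\mathbb{C}$ is a minimizer of $\|u\|_{L^1(\mathbb{Z}_N^d)}$ among all functions $u:\mathbb{Z}_N^d\to\mathbb{C}$ satisfying $\widehat u(m)=\widehat f(m)$ for all $m\notin S$, then $f\equiv g$.
   Context: $\mathbb{Z}_N=\mathbb{Z}/N\mathbb{Z}$, and $\chi(t)=e^{2\pi i t/N}$ for $t\in\mathbb{Z}_N$. The discrete Fourier transform of $f:\mathbb{Z}_N^d\to\mathbb{C}$ is $\widehat f(m)=N^{-d}\sum_{x\in\mathbb{Z}_N^d}\chi(-x\cdot m)f(x)$. "Supported in $E$" means $f(x)=0$ for $x\notin E$. For $A\subset\mathbb{Z}_N^d$, the additive energy is $\Lambda(A)=|\{(x_1,x_2,x_3,x_4)\in A^4: x_1+x_2=x_3+x_4\}|$. The norm is $\|u\|_{L^1(\mathbb{Z}_N^d)}=\sum_{x\in\mathbb{Z}_N^d}|u(x)|$. *)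

theory Defs
  imports "HOL-Analysis.Analysis" "Berlekamp_Zassenhaus.Finite_Field"
begin

text \<open>
  Throughout, \<open>\<int>\<^sub>N\<close> is the ring \<open>'n mod_ring\<close> with \<open>N = CARD('n)\<close>; the class constraint \<open>'n :: nontriv\<close>
  says exactly that \<open>N\<close> is finite and \<open>N \<ge> 2\<close>. The group \<open>\<int>\<^sub>N\<^sup>d\<close> is \<open>'n mod_ring ^ 'd\<close> with
  \<open>d = CARD('d) \<ge> 1\<close>. Addition and negation on both types are the modular ones.
\<close>

text \<open>
  \<open>to_int_mod_ring\<close> picks the representative in \<open>{0..<N}\<close>; since \<open>exp\<close> has period \<open>2 \<pi> \<i>\<close>, the value does not depend on this choice.
\<close>

definition chi :: "'n::nontriv mod_ring \<Rightarrow> complex" where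
  "chi t = exp (2 * of_real pi * \<i> * of_int (to_int_mod_ring t) / of_nat CARD('n))"

definition dot :: "'n::nontriv mod_ring ^ 'd::finite \<Rightarrow> 'n mod_ring ^ 'd \<Rightarrow> 'n mod_ring" where
  "dot x m = (\<Sum>i\<in>UNIV. x $ i * m $ i)"

definition dft :: "('n::nontriv mod_ring ^ 'd::finite \<Rightarrow> complex) \<Rightarrow> 'n mod_ring ^ 'd \<Rightarrow> complex" where
  "dft f m = (1 / of_nat (CARD('n) ^ CARD('d))) * (\<Sum>x\<in>UNIV. chi (dot (- x) m) * f x)"

definition supported_in :: "('a \<Rightarrow> complex) \<Rightarrow> 'a set \<Rightarrow> bool" where
  "supported_in f E \<longleftrightarrow> (\<forall>x. x \<notin> E \<longrightarrow> f x = 0)"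

definition additive_energy :: "('n::nontriv mod_ring ^ 'd::finite) set \<Rightarrow> nat" where
  "additive_energy A =
    card {(x1, x2, x3, x4). x1 \<in> A \<and> x2 \<in> A \<and> x3 \<in> A \<and> x4 \<in> A \<and> x1 + x2 = x3 + x4}"

definition l1_norm :: "('n::nontriv mod_ring ^ 'd::finite \<Rightarrow> complex) \<Rightarrow> real" where
  "l1_norm u = (\<Sum>x\<in>UNIV. cmod (u x))"

end

theory Submission
  imports Defs
begin

text \<open>
  Put \<open>h = g - f\<close>, so that the Fourier transform of \<open>h\<close> lives on \<open>S\<close> and is bounded by
  \<open>N\<^sup>-\<^sup>d \<parallel>h\<parallel>\<^sub>1\<close>. Expanding \<open>\<parallel>h\<parallel>\<^sub>4\<^sup>4 = \<parallel>h\<^sup>2\<parallel>\<^sub>2\<^sup>2\<close> by orthogonality leaves only the additive quadruples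
  of \<open>S\<close>, whence \<open>\<parallel>h\<parallel>\<^sub>4\<^sup>4 \<le> N\<^sup>d (N\<^sup>-\<^sup>d \<parallel>h\<parallel>\<^sub>1)\<^sup>4 \<Lambda>(S)\<close>. Hoelder's inequality on \<open>E\<close> then gives
  \<open>\<Sum>\<^bsub>x \<in> E\<^esub> |h x| \<le> \<delta> \<parallel>h\<parallel>\<^sub>1\<close>. If \<open>\<delta> < 1/2\<close> and \<open>h \<noteq> 0\<close>, the mass gained off \<open>E\<close> exceeds the
  mass that can be cancelled on \<open>E\<close>, so \<open>g\<close> has larger norm than \<open>f\<close>.
\<close>

section \<open>The additive character of \<int>_N\<close>

lemma chi_eq_cis:
  "chi (t :: 'n::nontriv mod_ring) = cis (2 * pi * real_of_int (to_int_mod_ring t) / real CARD('n))"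
  by (simp add: chi_def cis_conv_exp field_simps)

lemma norm_chi [simp]: "cmod (chi t) = 1"
  by (simp add: chi_eq_cis)

lemma chi_0 [simp]: "chi 0 = 1"
  by (simp add: chi_def)

lemma chi_add: "chi (a + b) = chi a * chi (b :: 'n::nontriv mod_ring)"
proof -
  define N where "N = int CARD('n)"
  have N: "N > 0" by (simp add: N_def)
  let ?s = "to_int_mod_ring a + to_int_mod_ring b"
  have "to_int_mod_ring (a + b) = ?s mod N"
    unfolding N_def by transfer simp
  \<comment> \<open>Representatives add only up to a multiple of N, which becomes a whole number of
    turns in \<open>cis\<close>.\<close>
  then have "?s = to_int_mod_ring (a + b) + N * (?s div N)"
    by (simp add: mod_div_mult_eq)
  then have "real_of_int ?s = real_of_int (to_int_mod_ring (a + b)) + real CARD('n) * real_of_int (?s div N)"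
    unfolding N_def by (metis of_int_add of_int_mult of_int_of_nat_eq)
  then have "2 * pi * real_of_int ?s / real CARD('n) =
      2 * pi * real_of_int (to_int_mod_ring (a + b)) / real CARD('n) + 2 * pi * real_of_int (?s div N)"
    by (simp add: field_simps)
  then have "cis (2 * pi * real_of_int ?s / real CARD('n)) = chi (a + b)"
    by (simp add: chi_eq_cis cis_mult[symmetric] cis_multiple_2pi)
  then show ?thesis
    by (simp add: chi_eq_cis cis_mult add_divide_distrib distrib_left)
qed

text \<open>Both sides are inverse to \<open>chi t\<close>: one by additivity, the other because
  \<open>chi t\<close> has modulus 1.\<close>

lemma chi_minus: "chi (- t) = cnj (chi t)"
proof -
  have "chi (- t) * chi t = 1"
    using chi_add[of "- t" t] by simp
  moreover have "cnj (chi t) * chi t = 1"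
    using complex_norm_square[of "chi t"] by (simp add: mult.commute)
  ultimately have "(chi (- t) - cnj (chi t)) * chi t = 0"
    by (simp add: left_diff_distrib)
  moreover have "chi t \<noteq> 0"
    using norm_chi[of t] by fastforce
  ultimately show ?thesis
    by simp
qed

lemma chi_eq_1_iff: "chi t = 1 \<longleftrightarrow> t = (0 :: 'n::nontriv mod_ring)"
proof
  assume "chi t = 1"
  then have "cos (2 * pi * real_of_int (to_int_mod_ring t) / real CARD('n)) = 1"
    by (metis chi_eq_cis cis.sel(1) one_complex.sel(1))
  then obtain k :: int where
    "2 * pi * real_of_int (to_int_mod_ring t) / real CARD('n) = real_of_int k * 2 * pi"
    using cos_one_2pi_int by blast
  then have "real_of_int (to_int_mod_ring t) = real_of_int (k * int CARD('n))"
    by (simp add: field_simps)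
  then have "to_int_mod_ring t = k * int CARD('n)"
    using of_int_eq_iff by blast
  \<comment> \<open>The representative is already reduced, so being a multiple of N forces it to be
    0.\<close>
  moreover have "to_int_mod_ring t mod int CARD('n) = to_int_mod_ring t"
    by transfer simp
  ultimately have "to_int_mod_ring t = 0"
    by simp
  then show "t = 0"
    by (simp add: to_int_mod_ring_hom.eq_iff flip: to_int_mod_ring_hom.hom_zero)
qed simp

section \<open>The pairing on \<int>_N^d and orthogonality of characters\<close>

lemma dot_add_left: "dot (x + y) m = dot x m + dot y m"
  by (simp add: dot_def distrib_right sum.distrib)

lemma dot_commute: "dot x m = dot m x"
  by (simp add: dot_def mult.commute)

lemma dot_add_right: "dot x (m + n) = dot x m + dot x n"
  by (metis dot_add_left dot_commute)

lemma dot_minus_left: "dot (- x) m = - dot x m"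
  by (simp add: dot_def sum_negf)

lemma dot_minus_right: "dot x (- m) = - dot x m"
  by (metis dot_minus_left dot_commute)

lemma dot_0_right [simp]: "dot x 0 = 0"
  by (simp add: dot_def)

lemma dot_axis_left: "dot (axis i 1) m = m $ i"
  by (simp add: dot_def axis_def if_distrib[of "\<lambda>c. c * _"] cong: if_cong)

text \<open>Translating the summation variable by a unit vector multiplies the sum by
  \<open>chi (m $ i)\<close>. If \<open>m $ i\<close> is nonzero this factor is not 1, so the sum
  vanishes.\<close>

lemma sum_chi_dot:
  fixes m :: "'n::nontriv mod_ring ^ 'd::finite"
  shows "(\<Sum>x\<in>UNIV. chi (dot x m)) = (if m = 0 then of_nat (CARD('n) ^ CARD('d)) else 0)"
proof (cases "m = 0")
  case True
  then show ?thesis by simp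
next
  case False
  then obtain i where i: "m $ i \<noteq> 0"
    by (auto simp: vec_eq_iff)
  have "(\<Sum>x\<in>UNIV. chi (dot x m)) = (\<Sum>x\<in>UNIV. chi (dot (axis i 1 + x) m))"
    by (rule sum.reindex_bij_witness[of _ "\<lambda>x. axis i 1 + x" "\<lambda>x. x - axis i 1"]) auto
  also have "\<dots> = chi (m $ i) * (\<Sum>x\<in>UNIV. chi (dot x m))"
    by (simp add: dot_add_left dot_axis_left chi_add sum_distrib_left)
  finally have "(1 - chi (m $ i)) * (\<Sum>x\<in>UNIV. chi (dot x m)) = 0"
    by (simp add: left_diff_distrib)
  then show ?thesis
    using i False by (simp add: chi_eq_1_iff)
qed

section \<open>Fourier inversion, fourth moments and concentration on a set\<close>

lemma dft_diff: "dft (\<lambda>x. u x - v x) m = dft u m - dft v m"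
  by (simp add: dft_def right_diff_distrib sum_subtractf)

lemma norm_dft_le:
  fixes u :: "'n::nontriv mod_ring ^ 'd::finite \<Rightarrow> complex"
  shows "cmod (dft u m) \<le> l1_norm u / real (CARD('n) ^ CARD('d))"
proof -
  have "cmod (\<Sum>x\<in>UNIV. chi (dot (- x) m) * u x) \<le> l1_norm u"
    unfolding l1_norm_def by (rule order_trans[OF norm_sum]) (simp add: norm_mult)
  then show ?thesis
    by (simp add: dft_def norm_mult norm_divide norm_power divide_right_mono)
qed

lemma fourier_inversion:
  fixes u :: "'n::nontriv mod_ring ^ 'd::finite \<Rightarrow> complex"
  shows "(\<Sum>m\<in>UNIV. dft u m * chi (dot x m)) = u x"
proof -
  define Q where "Q = (of_nat (CARD('n) ^ CARD('d)) :: complex)"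
  have Q: "Q \<noteq> 0" by (simp add: Q_def)
  have "chi (dot (- y) m) * chi (dot x m) = chi (dot m (x - y))" for y m
    by (simp add: dot_commute[of m] flip: chi_add dot_add_left)
  then have chi_dot_diff: "chi (dot x m) * chi (dot (- y) m) = chi (dot m (x - y))" for y m
    by (simp add: mult.commute)
  have "(\<Sum>m\<in>UNIV. dft u m * chi (dot x m)) =
      (\<Sum>m\<in>UNIV. \<Sum>y\<in>UNIV. u y / Q * chi (dot m (x - y)))"
    unfolding dft_def Q_def[symmetric]
    by (intro sum.cong refl)
      (simp add: sum_distrib_left sum_distrib_right sum_divide_distrib mult_ac
        flip: chi_dot_diff)
  also have "\<dots> = (\<Sum>y\<in>UNIV. u y / Q * (\<Sum>m\<in>UNIV. chi (dot m (x - y))))"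
    by (subst sum.swap) (simp add: sum_distrib_left)
  also have "\<dots> = (\<Sum>y\<in>UNIV. if y = x then u y else 0)"
    using Q by (intro sum.cong refl) (auto simp: sum_chi_dot Q_def)
  also have "\<dots> = u x" by simp
  finally show ?thesis .
qed

text \<open>A Parseval bound in which frequencies may repeat: after expanding the square, summation
  over \<open>x\<close> kills every pair with distinct frequencies, and each colliding pair
  contributes at most N^d M^2.\<close>

lemma sum_norm_square_exponential_sum_le:
  fixes \<phi> :: "'a \<Rightarrow> 'n::nontriv mod_ring ^ 'd::finite"
  assumes "finite P" and c: "\<And>p. p \<in> P \<Longrightarrow> cmod (c p) \<le> M"
  shows "(\<Sum>x\<in>UNIV. (cmod (\<Sum>p\<in>P. c p * chi (dot x (\<phi> p))))\<^sup>2) \<le>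
    real (CARD('n) ^ CARD('d)) * M\<^sup>2 * real (card {(p, q) \<in> P \<times> P. \<phi> p = \<phi> q})"
proof -
  define Q where "Q = real (CARD('n) ^ CARD('d))"
  define T where "T = {(p, q) \<in> P \<times> P. \<phi> p = \<phi> q}"
  have Q: "0 \<le> Q" by (simp add: Q_def)
  have T: "T \<subseteq> P \<times> P" "finite (P \<times> P)" using assms by (auto simp: T_def)
  let ?F = "\<lambda>x. \<Sum>p\<in>P. c p * chi (dot x (\<phi> p))"
  have "complex_of_real (\<Sum>x\<in>UNIV. (cmod (?F x))\<^sup>2) = (\<Sum>x\<in>UNIV. ?F x * cnj (?F x))"
    by (simp only: of_real_sum complex_norm_square)
  also have "\<dots> = (\<Sum>x\<in>UNIV. \<Sum>(p, q)\<in>P \<times> P. c p * cnj (c q) * chi (dot x (\<phi> p - \<phi> q)))"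
    by (intro sum.cong refl)
      (simp add: sum_product sum.cartesian_product dot_add_right dot_minus_right chi_add chi_minus
        diff_conv_add_uminus mult_ac del: add_uminus_conv_diff)
  also have "\<dots> = (\<Sum>(p, q)\<in>P \<times> P. c p * cnj (c q) * (\<Sum>x\<in>UNIV. chi (dot x (\<phi> p - \<phi> q))))"
    by (subst sum.swap) (simp add: sum_distrib_left case_prod_unfold)
  also have "\<dots> = (\<Sum>(p, q)\<in>P \<times> P. if (p, q) \<in> T then c p * cnj (c q) * of_real Q else 0)"
    by (intro sum.cong refl) (auto simp: sum_chi_dot Q_def T_def)
  also have "\<dots> = (\<Sum>(p, q)\<in>T. c p * cnj (c q) * of_real Q)"
    using T by (intro sum.mono_neutral_cong_right) auto
  finally have eq: "complex_of_real (\<Sum>x\<in>UNIV. (cmod (?F x))\<^sup>2) = \<dots>" .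
  have "(\<Sum>x\<in>UNIV. (cmod (?F x))\<^sup>2) = cmod (complex_of_real (\<Sum>x\<in>UNIV. (cmod (?F x))\<^sup>2))"
    unfolding norm_of_real by (simp add: sum_nonneg)
  also have "\<dots> \<le> (\<Sum>(p, q)\<in>T. M * M * Q)"
    unfolding eq
  proof (rule sum_norm_le, clarify)
    fix p q assume "(p, q) \<in> T"
    then have "cmod (c p) \<le> M" "cmod (c q) \<le> M"
      using T c by auto
    \<comment> \<open>The sign of \<open>M\<close> is not assumed; it follows once \<open>P\<close>
      has an element.\<close>
    moreover from this have "0 \<le> M"
      using norm_ge_zero order_trans by blast
    ultimately show "cmod (c p * cnj (c q) * of_real Q) \<le> M * M * Q"
      using Q by (simp add: norm_mult mult_mono mult_right_mono)
  qed
  also have "\<dots> = Q * M\<^sup>2 * real (card T)"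
    by (simp add: power2_eq_square)
  finally show ?thesis
    by (simp add: Q_def T_def)
qed

text \<open>By inversion, the square of \<open>u\<close> is an exponential sum indexed by
  \<open>S \<times> S\<close> with frequencies \<open>a + b\<close> and coefficients at most M^2, so
  its collisions are exactly the additive quadruples of \<open>S\<close>.\<close>

lemma sum_norm_power4_le:
  fixes u :: "'n::nontriv mod_ring ^ 'd::finite \<Rightarrow> complex"
  assumes "\<And>m. m \<notin> S \<Longrightarrow> dft u m = 0" and M: "\<And>m. cmod (dft u m) \<le> M"
  shows "(\<Sum>x\<in>UNIV. cmod (u x) ^ 4) \<le>
    real (CARD('n) ^ CARD('d)) * M ^ 4 * real (additive_energy S)"
proof -
  let ?c = "\<lambda>(a, b). dft u a * dft u b" and ?\<phi> = "\<lambda>(a, b). a + b"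
  have "u x = (\<Sum>m\<in>S. dft u m * chi (dot x m))" for x
    unfolding fourier_inversion[of u x, symmetric]
    using assms(1) by (intro sum.mono_neutral_right) auto
  then have "(u x)\<^sup>2 = (\<Sum>a\<in>S. dft u a * chi (dot x a)) * (\<Sum>b\<in>S. dft u b * chi (dot x b))" for x
    by (simp add: power2_eq_square)
  then have sq: "(u x)\<^sup>2 = (\<Sum>p\<in>S \<times> S. ?c p * chi (dot x (?\<phi> p)))" for x
    by (simp add: sum_product sum.cartesian_product dot_add_right chi_add case_prod_unfold mult_ac)
  have "cmod (u x) ^ 4 = (cmod ((u x)\<^sup>2))\<^sup>2" for x
    by (simp add: norm_power flip: power_mult)
  then have "(\<Sum>x\<in>UNIV. cmod (u x) ^ 4) =
      (\<Sum>x\<in>UNIV. (cmod (\<Sum>p\<in>S \<times> S. ?c p * chi (dot x (?\<phi> p))))\<^sup>2)"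
    by (simp only: sq)
  also have "\<dots> \<le> real (CARD('n) ^ CARD('d)) * (M\<^sup>2)\<^sup>2 *
      real (card {(p, q) \<in> (S \<times> S) \<times> S \<times> S. ?\<phi> p = ?\<phi> q})"
  proof (rule sum_norm_square_exponential_sum_le)
    fix p assume "p \<in> S \<times> S"
    have "0 \<le> M" using M norm_ge_zero order_trans by blast
    then show "cmod (?c p) \<le> M\<^sup>2"
      using M by (auto simp: case_prod_unfold norm_mult power2_eq_square intro!: mult_mono)
  qed simp
  also have "card {(p, q) \<in> (S \<times> S) \<times> S \<times> S. ?\<phi> p = ?\<phi> q} = additive_energy S"
    unfolding additive_energy_def
    by (rule bij_betw_same_card[of "\<lambda>((a, b), (c, d)). (a, b, c, d)"])
      (rule bij_betwI[where g = "\<lambda>(a, b, c, d). ((a, b), (c, d))"], auto)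
  finally show ?thesis
    by (simp flip: power_mult)
qed

text \<open>Cauchy-Schwarz against the constant 1, applied twice.\<close>

lemma power4_sum_le:
  fixes a :: "'a \<Rightarrow> real"
  shows "(\<Sum>x\<in>A. a x) ^ 4 \<le> real (card A) ^ 3 * (\<Sum>x\<in>A. a x ^ 4)"
proof -
  have "(\<Sum>x\<in>A. a x) ^ 4 = ((\<Sum>x\<in>A. a x)\<^sup>2)\<^sup>2"
    by (simp flip: power_mult)
  also have "\<dots> \<le> ((\<Sum>x\<in>A. (a x)\<^sup>2) * real (card A))\<^sup>2"
    by (intro power_mono sum_squared_le_sum_of_squares) simp
  also have "\<dots> = real (card A) ^ 2 * (\<Sum>x\<in>A. (a x)\<^sup>2)\<^sup>2"
    by (simp add: power_mult_distrib)
  also have "\<dots> \<le> real (card A) ^ 2 * ((\<Sum>x\<in>A. ((a x)\<^sup>2)\<^sup>2) * real (card A))"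
    by (intro mult_left_mono sum_squared_le_sum_of_squares) simp
  also have "\<dots> = real (card A) ^ 3 * (\<Sum>x\<in>A. a x ^ 4)"
    by (simp add: power2_eq_square power3_eq_cube power4_eq_xxxx mult_ac)
  finally show ?thesis .
qed

lemma sum_norm_le_of_dft_supported:
  fixes u :: "'n::nontriv mod_ring ^ 'd::finite \<Rightarrow> complex"
  assumes "\<And>m. m \<notin> S \<Longrightarrow> dft u m = 0"
  shows "(\<Sum>x\<in>E. cmod (u x)) \<le>
    (real (card E) * real (additive_energy S) powr (1/3) / real (CARD('n) ^ CARD('d))) powr (3/4)
      * l1_norm u"
    (is "_ \<le> ?\<delta> * _")
proof -
  define Q where "Q = real (CARD('n) ^ CARD('d))"
  define L where "L = real (additive_energy S)"
  have Q: "Q > 0" by (simp add: Q_def)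
  \<comment> \<open>The fourth power clears both fractional exponents. The power Q^3 in the
    denominator matches the factor Q * Q^(-4) from the fourth moment bound with M =
    \<open>l1_norm u / Q\<close>.\<close>
  have \<delta>4: "?\<delta> ^ 4 = real (card E) ^ 3 * L / Q ^ 3"
  proof -
    have "(L powr (1/3)) ^ 3 = L"
      by (cases "L = 0") (simp_all add: L_def powr_power)
    moreover have "(t powr (3/4)) ^ 4 = t ^ 3" if "t \<ge> 0" for t :: real
      using that by (cases "t = 0") (simp_all add: powr_power)
    ultimately show ?thesis
      using Q unfolding Q_def[symmetric] L_def[symmetric]
      by (simp add: power_divide power_mult_distrib)
  qed
  have "(\<Sum>x\<in>E. cmod (u x)) ^ 4 \<le> real (card E) ^ 3 * (\<Sum>x\<in>E. cmod (u x) ^ 4)"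
    by (rule power4_sum_le)
  also have "\<dots> \<le> real (card E) ^ 3 * (\<Sum>x\<in>UNIV. cmod (u x) ^ 4)"
    by (intro mult_left_mono sum_mono2) auto
  also have "\<dots> \<le> real (card E) ^ 3 * (Q * (l1_norm u / Q) ^ 4 * L)"
    unfolding Q_def L_def
    by (intro mult_left_mono sum_norm_power4_le assms norm_dft_le) auto
  also have "\<dots> = (?\<delta> * l1_norm u) ^ 4"
    unfolding power_mult_distrib \<delta>4
    using Q by (simp add: field_simps power_divide eval_nat_numeral)
  finally show ?thesis
    by (rule power_mono_iff[THEN iffD1, rotated 3]) (simp_all add: l1_norm_def sum_nonneg)
qed

theorem theorem2p1:
  fixes f g :: "'n::nontriv mod_ring ^ 'd::finite \<Rightarrow> complex"
    and E S :: "('n mod_ring ^ 'd) set"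
    and \<delta> :: real
  assumes "supported_in f E"
    and "\<exists>C \<alpha> :: real. C > 0 \<and> \<alpha> \<in> {2..3} \<and>
           real (additive_energy S) \<le> C * real (card S) powr \<alpha>"
    and "\<delta> = (real (card E) * real (additive_energy S) powr (1/3)
                / real (CARD('n) ^ CARD('d))) powr (3/4)"
    and "\<delta> < 1/2"
    and "is_arg_min l1_norm (\<lambda>u. \<forall>m. m \<notin> S \<longrightarrow> dft u m = dft f m) g"
  shows "f = g"
proof -
  define h where "h = (\<lambda>x. g x - f x)"
  have split_sum: "l1_norm u = (\<Sum>x\<in>E. cmod (u x)) + (\<Sum>x\<in>-E. cmod (u x))"
    for u :: "'n mod_ring ^ 'd \<Rightarrow> complex"
    unfolding l1_norm_def by (subst sum.union_disjoint[symmetric]) auto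
  have f0: "f x = 0" if "x \<in> - E" for x
    using assms(1) that by (auto simp: supported_in_def)
  have dft_h: "dft h m = 0" if "m \<notin> S" for m
    using assms(5) that by (simp add: h_def dft_diff is_arg_min_def)
  have "l1_norm g \<le> l1_norm f"
    using assms(5) by (auto simp: is_arg_min_def not_less)
  moreover have "(\<Sum>x\<in>E. cmod (f x)) \<le> (\<Sum>x\<in>E. cmod (g x)) + (\<Sum>x\<in>E. cmod (h x))"
    unfolding h_def sum.distrib[symmetric]
    by (intro sum_mono) (metis add.commute norm_minus_commute norm_triangle_sub)
  moreover have "(\<Sum>x\<in>-E. cmod (h x)) = (\<Sum>x\<in>-E. cmod (g x))" "(\<Sum>x\<in>-E. cmod (f x)) = 0"
    by (simp_all add: h_def f0)
  \<comment> \<open>Off \<open>E\<close> the functions \<open>h\<close> and \<open>g\<close> agree,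
    so minimality bounds the mass of \<open>h\<close> there by the loss from \<open>f\<close> to
    \<open>g\<close> on \<open>E\<close>, which is at most the mass of \<open>h\<close> on
    \<open>E\<close>.\<close>
  ultimately have "(\<Sum>x\<in>-E. cmod (h x)) \<le> (\<Sum>x\<in>E. cmod (h x))"
    unfolding split_sum[of f] split_sum[of g] by linarith
  moreover have "(\<Sum>x\<in>E. cmod (h x)) \<le> \<delta> * l1_norm h"
    unfolding assms(3) using dft_h by (rule sum_norm_le_of_dft_supported)
  \<comment> \<open>At least half of the mass of \<open>h\<close> lies on \<open>E\<close>, yet at
    most the fraction \<delta> can; as \<delta> < 1/2, the total must be 0.\<close>
  ultimately have "(1 - 2 * \<delta>) * l1_norm h \<le> 0"
    using split_sum[of h] by (simp add: algebra_simps)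
  then have "l1_norm h \<le> 0"
    using assms(4) by (simp add: mult_le_0_iff)
  then have "h x = 0" for x
    using sum_nonneg_eq_0_iff[of UNIV "\<lambda>x. cmod (h x)"] sum_nonneg[of UNIV "\<lambda>x. cmod (h x)"]
    by (auto simp: l1_norm_def)
  then show ?thesis
    by (auto simp: h_def fun_eq_iff)
qed

end
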